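(* Let $(x_n,f_n)_{n=1}^\infty$ be an unconditional Schauder frame of a reflexive Banach space $X$. Let $\{g_n\}_{n=1}^\infty$ be a sequence in $X^*$ which satisfies $$\mu:=\sum_{n=1}^\infty\|f_n-g_n\|\cdot\|x_n\|<1.$$ Then there is a sequence $\{y_n\}_{n=1}^\infty$ in $X$ such that $(y_n,g_n)_{n=1}^\infty$ is an unconditional Schauder frame of $X$.
   Context: Let $X$ be a separable Banach space. A sequence $(x_n,f_n)_{n=1}^\infty$ with $x_n\in X$, $f_n\in X^*$ is a Schauder frame of $X$ if $x=\sum_{n=1}^\infty f_n(x)x_n$ (norm convergence) for every $x\in X$; it is an unconditional Schauder frame if this series converges unconditionally for every $x\in X$. *)

theory Defs
  imports "HOL-Analysis.Analysis"
begin

text \<open>Banach spaces are real; the dual of \<open>'a\<close> is the type \<open>'a \<Rightarrow>\<^sub>L real\<close> with its operator norm.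
  Sequences are indexed from 0, so the entry at index \<open>n\<close> is the \<open>(n+1)\<close>-st term.\<close>

definition canonical_embedding :: "'a::real_normed_vector \<Rightarrow> (('a \<Rightarrow>\<^sub>L real) \<Rightarrow>\<^sub>L real)"
  where "canonical_embedding x = Blinfun (\<lambda>f. blinfun_apply f x)"

lemma canonical_embedding_apply [simp]:
  "blinfun_apply (canonical_embedding x) f = blinfun_apply f x"
  unfolding canonical_embedding_def
  by (simp add: bounded_linear_Blinfun_apply blinfun.bounded_linear_left)

definition reflexive_space :: "'a::real_normed_vector itself \<Rightarrow> bool"
  where "reflexive_space _ \<longleftrightarrow>
    surj (canonical_embedding :: 'a \<Rightarrow> (('a \<Rightarrow>\<^sub>L real) \<Rightarrow>\<^sub>L real))"

definition unconditionally_convergent :: "(nat \<Rightarrow> 'a::real_normed_vector) \<Rightarrow> bool"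
  where "unconditionally_convergent u \<longleftrightarrow> (\<forall>p. bij p \<longrightarrow> summable (\<lambda>n. u (p n)))"

definition schauder_frame ::
    "(nat \<Rightarrow> 'a::real_normed_vector) \<Rightarrow> (nat \<Rightarrow> 'a \<Rightarrow>\<^sub>L real) \<Rightarrow> bool"
  where "schauder_frame x f \<longleftrightarrow> (\<forall>v. (\<lambda>n. blinfun_apply (f n) v *\<^sub>R x n) sums v)"

definition unconditional_schauder_frame ::
    "(nat \<Rightarrow> 'a::real_normed_vector) \<Rightarrow> (nat \<Rightarrow> 'a \<Rightarrow>\<^sub>L real) \<Rightarrow> bool"
  where "unconditional_schauder_frame x f \<longleftrightarrow>
    schauder_frame x f \<and>
    (\<forall>v. unconditionally_convergent (\<lambda>n. blinfun_apply (f n) v *\<^sub>R x n))"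

end

theory Submission
  imports Defs
begin

text \<open>The operator \<open>T v = \<Sum>n. g\<^sub>n(v) x\<^sub>n\<close> differs from the identity by
  \<open>S v = \<Sum>n. (f\<^sub>n - g\<^sub>n)(v) x\<^sub>n\<close>, whose norm is at most \<open>\<mu> < 1\<close>. Hence \<open>T\<close> is invertible, and
  \<open>y\<^sub>n = T\<^sup>-\<^sup>1 x\<^sub>n\<close> works. Unconditional convergence survives because \<open>(f\<^sub>n - g\<^sub>n)(v) x\<^sub>n\<close> is
  absolutely summable.\<close>

text \<open>For fixed \<open>w\<close> the map sending \<open>v\<close> to \<open>w + S v\<close> is
  a \<open>c\<close>-contraction of a complete space, and its fixed point solves
  \<open>v - S v = w\<close>. This yields a right inverse \<open>R\<close> of id - S; an a priori
  estimate then makes id - S injective and \<open>R\<close> bounded.\<close>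

lemma bounded_linear_left_inverse_id_minus:
  fixes S :: "'a::banach \<Rightarrow> 'a"
  assumes S: "bounded_linear S"
    and le: "\<And>v. norm (S v) \<le> c * norm v"
    and c: "0 \<le> c" "c < 1"
  obtains R where "bounded_linear R" "\<And>v. R (v - S v) = v"
proof -
  interpret S: bounded_linear S by fact
  have "\<exists>v. v - S v = w" for w
  proof -
    have "\<exists>!v. w + S v = v"
    proof (rule banach_fix_type[OF c], intro allI)
      fix u v
      show "dist (w + S u) (w + S v) \<le> c * dist u v"
        using le[of "u - v"] by (simp add: dist_norm S.diff)
    qed
    then obtain v where "w + S v = v" by blast
    then have "v - S v = w" by (simp only: diff_eq_eq)
    then show ?thesis ..
  qed
  then obtain R where TR: "\<And>w. R w - S (R w) = w" by metis
  \<comment> \<open>The triangle inequality and \<open>c < 1\<close> bound id - S from below. At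
    \<open>u - v\<close> this gives injectivity; at \<open>R v\<close> it gives the operator bound
    for \<open>R\<close>.\<close>
  have bound: "norm v \<le> norm (v - S v) * inverse (1 - c)" for v
  proof -
    have "norm v \<le> norm (v - S v) + norm (S v)"
      using norm_triangle_ineq[of "v - S v" "S v"] by simp
    then have "norm v * (1 - c) \<le> norm (v - S v)"
      using le[of v] by (simp add: algebra_simps)
    then show ?thesis using c by (simp add: pos_le_divide_eq flip: divide_inverse)
  qed
  have inj: "u = v" if "u - S u = v - S v" for u v
  proof -
    have "u - v - S (u - v) = (u - S u) - (v - S v)"
      by (simp add: S.diff)
    also have "\<dots> = 0" by (simp only: that diff_self)
    finally show ?thesis using bound[of "u - v"] by simp
  qed
  show thesis
  proof
    \<comment> \<open>By \<open>TR\<close> both sides have the same image under id - S, so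
      injectivity turns the right inverse into a left inverse.\<close>
    show "R (v - S v) = v" for v
      by (rule inj) (rule TR)
    \<comment> \<open>Linearity is checked after applying id - S, which is linear and injective and
      cancels \<open>R\<close> by \<open>TR\<close>.\<close>
    show "bounded_linear R"
    proof (rule bounded_linear_intro)
      show "R (u + v) = R u + R v" for u v
      proof (rule inj)
        have "R u + R v - S (R u + R v) = (R u - S (R u)) + (R v - S (R v))"
          by (simp add: S.add)
        then show "R (u + v) - S (R (u + v)) = R u + R v - S (R u + R v)"
          by (simp only: TR)
      qed
      show "R (r *\<^sub>R v) = r *\<^sub>R R v" for r v
      proof (rule inj)
        have "r *\<^sub>R R v - S (r *\<^sub>R R v) = r *\<^sub>R (R v - S (R v))"
          by (simp add: S.scaleR scaleR_diff_right)
        then show "R (r *\<^sub>R v) - S (R (r *\<^sub>R v)) = r *\<^sub>R R v - S (r *\<^sub>R R v)"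
          by (simp only: TR)
      qed
      show "norm (R v) \<le> norm v * inverse (1 - c)" for v
        using bound[of "R v"] by (simp only: TR)
    qed
  qed
qed

text \<open>A convergent series of nonnegative reals may be reindexed injectively, and completeness
  turns absolute summability of the rearranged series into convergence.\<close>

lemma unconditionally_convergent_if_abs_summable:
  fixes u :: "nat \<Rightarrow> 'a::banach"
  assumes "summable (\<lambda>n. norm (u n))"
  shows "unconditionally_convergent u"
  unfolding unconditionally_convergent_def
proof (intro allI impI)
  fix p :: "nat \<Rightarrow> nat" assume "bij p"
  then have "summable ((\<lambda>n. norm (u n)) \<circ> p)"
    by (rule summable_reindex[OF assms bij_is_inj]) simp
  then show "summable (\<lambda>n. u (p n))"
    unfolding o_def by (rule summable_norm_cancel)
qed

lemma unconditionally_convergent_diff: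
  "unconditionally_convergent u \<Longrightarrow> unconditionally_convergent v \<Longrightarrow>
    unconditionally_convergent (\<lambda>n. u n - v n)"
  unfolding unconditionally_convergent_def
  using summable_diff[of "\<lambda>n. u (p n)" "\<lambda>n. v (p n)" for p] by simp

lemma unconditionally_convergent_bounded_linear:
  "bounded_linear R \<Longrightarrow> unconditionally_convergent u \<Longrightarrow>
    unconditionally_convergent (\<lambda>n. R (u n))"
  unfolding unconditionally_convergent_def
  using bounded_linear.summable[of R "\<lambda>n. u (p n)" for p] by simp

text \<open>Everything follows from the termwise bound
  \<open>norm (h n) * norm (x n) * norm v\<close>. With \<open>h n = f n - g n\<close> the constant
  in the norm estimate is \<mu>.\<close>

lemma bounded_linear_suminf_blinfun_scaleR:
  fixes x :: "nat \<Rightarrow> 'a::banach" and h :: "nat \<Rightarrow> 'b::real_normed_vector \<Rightarrow>\<^sub>L real"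
  assumes sm: "summable (\<lambda>n. norm (h n) * norm (x n))"
  shows "summable (\<lambda>n. norm (blinfun_apply (h n) v *\<^sub>R x n))"
    and "norm (\<Sum>n. blinfun_apply (h n) v *\<^sub>R x n) \<le> (\<Sum>n. norm (h n) * norm (x n)) * norm v"
    and "bounded_linear (\<lambda>v. \<Sum>n. blinfun_apply (h n) v *\<^sub>R x n)"
proof -
  have le: "norm (blinfun_apply (h n) v *\<^sub>R x n) \<le> norm (h n) * norm (x n) * norm v" for n v
    using mult_right_mono[OF norm_blinfun[of "h n" v], of "norm (x n)"]
    by (simp add: mult_ac)
  have abs: "summable (\<lambda>n. norm (blinfun_apply (h n) v *\<^sub>R x n))" for v
    by (rule summable_comparison_test'[OF summable_mult2[OF sm, of "norm v"], of 0])
       (use le in auto)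
  note summ = summable_norm_cancel[OF abs]
  have bd: "norm (\<Sum>n. blinfun_apply (h n) v *\<^sub>R x n) \<le> (\<Sum>n. norm (h n) * norm (x n)) * norm v" for v
  proof -
    have "norm (\<Sum>n. blinfun_apply (h n) v *\<^sub>R x n) \<le> (\<Sum>n. norm (blinfun_apply (h n) v *\<^sub>R x n))"
      by (rule summable_norm[OF abs])
    also have "\<dots> \<le> (\<Sum>n. norm (h n) * norm (x n) * norm v)"
      by (rule suminf_le[OF le abs summable_mult2[OF sm]])
    also have "\<dots> = (\<Sum>n. norm (h n) * norm (x n)) * norm v"
      by (rule suminf_mult2[OF sm, symmetric])
    finally show ?thesis .
  qed
  show "summable (\<lambda>n. norm (blinfun_apply (h n) v *\<^sub>R x n))"
    by (rule abs)
  show "norm (\<Sum>n. blinfun_apply (h n) v *\<^sub>R x n) \<le> (\<Sum>n. norm (h n) * norm (x n)) * norm v"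
    by (rule bd)
  show "bounded_linear (\<lambda>v. \<Sum>n. blinfun_apply (h n) v *\<^sub>R x n)"
  proof (rule bounded_linear_intro)
    show "(\<Sum>n. blinfun_apply (h n) (u + v) *\<^sub>R x n) =
        (\<Sum>n. blinfun_apply (h n) u *\<^sub>R x n) + (\<Sum>n. blinfun_apply (h n) v *\<^sub>R x n)" for u v
      by (simp only: suminf_add[OF summ summ] blinfun.add_right scaleR_add_left)
    show "(\<Sum>n. blinfun_apply (h n) (r *\<^sub>R v) *\<^sub>R x n) =
        r *\<^sub>R (\<Sum>n. blinfun_apply (h n) v *\<^sub>R x n)" for r v
      by (simp only: suminf_scaleR_right[OF summ, symmetric] blinfun.scaleR_right
          real_scaleR_def scaleR_scaleR[symmetric])
    show "norm (\<Sum>n. blinfun_apply (h n) v *\<^sub>R x n) \<le> norm v * (\<Sum>n. norm (h n) * norm (x n))" for v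
      using bd[of v] by (simp add: mult.commute)
  qed
qed

theorem theorem3p5:
  fixes x :: "nat \<Rightarrow> 'a::banach"
    and f g :: "nat \<Rightarrow> 'a \<Rightarrow>\<^sub>L real"
  assumes "separable_space (euclidean :: 'a topology)"
    and "reflexive_space TYPE('a)"
    and "unconditional_schauder_frame x f"
    and "summable (\<lambda>n. norm (f n - g n) * norm (x n))"
    and "(\<Sum>n. norm (f n - g n) * norm (x n)) < 1"
  shows "\<exists>y :: nat \<Rightarrow> 'a. unconditional_schauder_frame y g"
proof -
  define S where "S v = (\<Sum>n. blinfun_apply (f n - g n) v *\<^sub>R x n)" for v
  note S = bounded_linear_suminf_blinfun_scaleR[OF assms(4), folded S_def]
  \<comment> \<open>The contraction constant is \<mu> itself, and the fixed point theorem asks for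
    it to be nonnegative.\<close>
  have "0 \<le> (\<Sum>n. norm (f n - g n) * norm (x n))"
    by (rule suminf_nonneg[OF assms(4)]) simp
  then obtain R where R: "bounded_linear R" and RT: "\<And>v. R (v - S v) = v"
    using bounded_linear_left_inverse_id_minus[OF S(3,2) _ assms(5)] by blast
  interpret R: bounded_linear R by fact
  \<comment> \<open>This splitting passes both kinds of convergence from the frame series and the
    absolutely summable perturbation to the series of \<open>g\<close>.\<close>
  have g: "blinfun_apply (g n) v *\<^sub>R x n =
      blinfun_apply (f n) v *\<^sub>R x n - blinfun_apply (f n - g n) v *\<^sub>R x n" for n v
    by (simp add: blinfun.diff_left scaleR_diff_left)
  have f: "(\<lambda>n. blinfun_apply (f n) v *\<^sub>R x n) sums v"
    "unconditionally_convergent (\<lambda>n. blinfun_apply (f n) v *\<^sub>R x n)" for v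
    using assms(3) unfolding unconditional_schauder_frame_def schauder_frame_def by auto
  have "(\<lambda>n. blinfun_apply (g n) v *\<^sub>R R (x n)) sums v" for v
  proof -
    \<comment> \<open>The series of \<open>g\<close> against \<open>x\<close> sums to
      \<open>v - S v\<close>; the bounded operator \<open>R\<close> may be applied term by term and
      sends this sum back to \<open>v\<close>.\<close>
    have "(\<lambda>n. blinfun_apply (f n - g n) v *\<^sub>R x n) sums S v"
      unfolding S_def by (rule summable_sums[OF summable_norm_cancel[OF S(1)]])
    then have "(\<lambda>n. blinfun_apply (g n) v *\<^sub>R x n) sums (v - S v)"
      unfolding g by (rule sums_diff[OF f(1)])
    from R.sums[OF this] show ?thesis by (simp add: R.scaleR RT)
  qed
  moreover have "unconditionally_convergent (\<lambda>n. blinfun_apply (g n) v *\<^sub>R R (x n))" for v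
  proof -
    have "unconditionally_convergent (\<lambda>n. blinfun_apply (g n) v *\<^sub>R x n)"
      unfolding g
      by (intro unconditionally_convergent_diff f(2)
          unconditionally_convergent_if_abs_summable S(1))
    from unconditionally_convergent_bounded_linear[OF R this]
    show ?thesis by (simp add: R.scaleR)
  qed
  ultimately have "unconditional_schauder_frame (\<lambda>n. R (x n)) g"
    unfolding unconditional_schauder_frame_def schauder_frame_def by blast
  then show ?thesis by blast
qed

end
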